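(* Consider a LASSO (respectively CLASSO) problem and the corresponding LCA system $\dot{\mathbf{u}}=\mathbf{F}(\mathbf{u})$. Let $\mathcal{M}$ be the largest positive invariant set inside $\mathcal{S}=\{\mathbf{u}\in\mathbb{R}^N\mid W(\mathbf{u})=0\}$. Then $\mathcal{M}=\hat{\mathcal{F}}$, where $\hat{\mathcal{F}}=\mathbf{T}^{-1}(\mathcal{C})$ is the fixed region. In particular, given an arbitrary flow $\mathbf{u}(t)=\mathbf{U}(t,\mathbf{u}^{(0)})$, $\mathbf{u}^{(0)}\in\mathbb{R}^N$, one has $\mathbf{u}(t)\to\hat{\mathcal{F}}$ and $\mathbf{T}(\mathbf{u}(t))\to\mathcal{C}$ as $t\to\infty$.
   Context: Data: $\mathbf{s}\in\mathbb{R}^M$, a real number $\lambda>0$, and a matrix $\Phi=[\boldsymbol\phi_1,\ldots,\boldsymbol\phi_N]\in\mathbb{R}^{M\times N}$ whose columns have unit Euclidean norm. Put $E(\mathbf{a})=\frac12\|\mathbf{s}-\Phi\mathbf{a}\|_2^2+\lambda\|\mathbf{a}\|_1$ for $\mathbf{a}\in\mathbb{R}^N$. LASSO is the problem of minimizing $E$ over $\mathbb{R}^N$; CLASSO is the problem of minimizing $E$ over $\{\mathbf{a}\in\mathbb{R}^N\mid a_n\ge 0 \text{ for all } n\}$. $\mathcal{C}$ denotes the set of optimal solutions of the problem considered. Activation function: let $T_\lambda(x)=x-\lambda$ for $x>\lambda$ and $T_\lambda(x)=0$ for $x\le\lambda$; let $T_{\pm\lambda}(x)=T_\lambda(x)-T_\lambda(-x)$.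 Set $T=T_{\pm\lambda}$ for LASSO and $T=T_\lambda$ for CLASSO, and let $\mathbf{T}:\mathbb{R}^N\to\mathbb{R}^N$ apply $T$ to each component. LCA is the dynamical system $\dot{\mathbf{u}}=\mathbf{F}(\mathbf{u})$, $\mathbf{F}(\mathbf{u})=\mathbf{b}-\mathbf{u}-(\Phi^T\Phi-I)\mathbf{T}(\mathbf{u})$, $\mathbf{b}=\Phi^T\mathbf{s}$. Its solution for $t\ge0$ with initial position $\mathbf{u}^{(0)}$ is the flow $\mathbf{U}(t,\mathbf{u}^{(0)})$. For $\mathbf{a}\in\mathbb{R}^N$, $\mathcal{A}(\mathbf{a})=\{n\mid a_n\ne0\}$. For $\mathbf{u}\in\mathbb{R}^N$ and $\mathbf{a}=\mathbf{T}(\mathbf{u})$, define $V(\mathbf{u})=E(\mathbf{a})$ and $W(\mathbf{u})=\sum_{n\in\mathcal{A}(\mathbf{a})}\frac{\partial V}{\partial u_n}(\mathbf{u})\,F_n(\mathbf{u})$ if $\mathcal{A}(\mathbf{a})\ne\emptyset$, $W(\mathbf{u})=0$ if $\mathcal{A}(\mathbf{a})=\emptyset$. A set $\mathcal{X}\subseteq\mathbb{R}^N$ is positive invariant if $\mathbf{U}(t,\mathbf{u}^{(0)})\in\mathcal{X}$ for all $\mathbf{u}^{(0)}\in\mathcal{X}$ and $t\ge0$. A curve $\mathbf{x}(t)$ converges to a set $\mathcal{X}$, $\mathbf{x}(t)\to\mathcal{X}$, if $\lim_{t\to\infty}\inf_{\mathbf{y}\in\mathcal{X}}\|\mathbf{x}(t)-\mathbf{y}\|_2=0$.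 *)

theory Defs
  imports "HOL-Analysis.Analysis"
begin

datatype lca_problem = LASSO | CLASSO

definition energy :: "real ^ 'm \<Rightarrow> real ^ 'n ^ 'm \<Rightarrow> real \<Rightarrow> real ^ 'n \<Rightarrow> real" where
  "energy s \<Phi> lam a = 1 / 2 * (norm (s - \<Phi> *v a))\<^sup>2 + lam * (\<Sum>n\<in>UNIV. \<bar>a $ n\<bar>)"

fun feasible :: "lca_problem \<Rightarrow> (real ^ 'n) set" where
  "feasible LASSO = UNIV"
| "feasible CLASSO = {a. \<forall>n. a $ n \<ge> 0}"

definition optimal_solutions ::
    "lca_problem \<Rightarrow> real ^ 'm \<Rightarrow> real ^ 'n ^ 'm \<Rightarrow> real \<Rightarrow> (real ^ 'n) set" where
  "optimal_solutions p s \<Phi> lam =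
     {a \<in> feasible p. \<forall>a' \<in> feasible p. energy s \<Phi> lam a \<le> energy s \<Phi> lam a'}"

definition one_sided_threshold :: "real \<Rightarrow> real \<Rightarrow> real" where
  "one_sided_threshold lam x = (if x > lam then x - lam else 0)"

fun threshold :: "lca_problem \<Rightarrow> real \<Rightarrow> real \<Rightarrow> real" where
  "threshold LASSO lam x = one_sided_threshold lam x - one_sided_threshold lam (- x)"
| "threshold CLASSO lam x = one_sided_threshold lam x"

definition activation :: "lca_problem \<Rightarrow> real \<Rightarrow> real ^ 'n \<Rightarrow> real ^ 'n" where
  "activation p lam u = (\<chi> n. threshold p lam (u $ n))"

definition lca_field ::
    "lca_problem \<Rightarrow> real ^ 'm \<Rightarrow> real ^ 'n ^ 'm \<Rightarrow> real \<Rightarrow> real ^ 'n \<Rightarrow> real ^ 'n" where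
  "lca_field p s \<Phi> lam u =
     transpose \<Phi> *v s - u - (transpose \<Phi> ** \<Phi> - mat 1) *v activation p lam u"

definition lca_solution ::
    "lca_problem \<Rightarrow> real ^ 'm \<Rightarrow> real ^ 'n ^ 'm \<Rightarrow> real \<Rightarrow> real ^ 'n \<Rightarrow> (real \<Rightarrow> real ^ 'n) \<Rightarrow> bool"
  where
  "lca_solution p s \<Phi> lam u0 u \<longleftrightarrow>
     u 0 = u0 \<and>
     (\<forall>t\<ge>0. (u has_vector_derivative lca_field p s \<Phi> lam (u t)) (at t within {0..}))"

(* The vector field is globally Lipschitz, so for every u0 there is a solution on {0..} and its
   values at times t >= 0 are unique.  The description is applied to the value at time t rather
   than to the solution, since lca_solution leaves u unconstrained at negative times. *)
definition lca_flow ::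
    "lca_problem \<Rightarrow> real ^ 'm \<Rightarrow> real ^ 'n ^ 'm \<Rightarrow> real \<Rightarrow> real \<Rightarrow> real ^ 'n \<Rightarrow> real ^ 'n" where
  "lca_flow p s \<Phi> lam t u0 = (THE x. \<exists>u. lca_solution p s \<Phi> lam u0 u \<and> x = u t)"

definition active :: "real ^ 'n \<Rightarrow> 'n set" where
  "active a = {n. a $ n \<noteq> 0}"

definition lca_V ::
    "lca_problem \<Rightarrow> real ^ 'm \<Rightarrow> real ^ 'n ^ 'm \<Rightarrow> real \<Rightarrow> real ^ 'n \<Rightarrow> real" where
  "lca_V p s \<Phi> lam u = energy s \<Phi> lam (activation p lam u)"

(* A coordinatewise derivative, not a Frechet derivative: lca_V need not be totally
   differentiable at u when an inactive coordinate lies on the threshold. *)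
definition partial_deriv :: "(real ^ 'n \<Rightarrow> real) \<Rightarrow> 'n \<Rightarrow> real ^ 'n \<Rightarrow> real" where
  "partial_deriv f n u = deriv (\<lambda>h. f (u + h *\<^sub>R axis n 1)) 0"

definition lca_W ::
    "lca_problem \<Rightarrow> real ^ 'm \<Rightarrow> real ^ 'n ^ 'm \<Rightarrow> real \<Rightarrow> real ^ 'n \<Rightarrow> real" where
  "lca_W p s \<Phi> lam u =
     (if active (activation p lam u) = {} then 0
      else \<Sum>n\<in>active (activation p lam u).
             partial_deriv (lca_V p s \<Phi> lam) n u * lca_field p s \<Phi> lam u $ n)"

definition positive_invariant ::
    "lca_problem \<Rightarrow> real ^ 'm \<Rightarrow> real ^ 'n ^ 'm \<Rightarrow> real \<Rightarrow> (real ^ 'n) set \<Rightarrow> bool" where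
  "positive_invariant p s \<Phi> lam X \<longleftrightarrow> (\<forall>u0\<in>X. \<forall>t\<ge>0. lca_flow p s \<Phi> lam t u0 \<in> X)"

definition largest_positive_invariant_inside ::
    "lca_problem \<Rightarrow> real ^ 'm \<Rightarrow> real ^ 'n ^ 'm \<Rightarrow> real \<Rightarrow> (real ^ 'n) set \<Rightarrow> (real ^ 'n) set \<Rightarrow> bool"
  where
  "largest_positive_invariant_inside p s \<Phi> lam S M \<longleftrightarrow>
     positive_invariant p s \<Phi> lam M \<and> M \<subseteq> S \<and>
     (\<forall>X. positive_invariant p s \<Phi> lam X \<and> X \<subseteq> S \<longrightarrow> X \<subseteq> M)"

definition fixed_region ::
    "lca_problem \<Rightarrow> real ^ 'm \<Rightarrow> real ^ 'n ^ 'm \<Rightarrow> real \<Rightarrow> (real ^ 'n) set" where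
  "fixed_region p s \<Phi> lam = activation p lam -` optimal_solutions p s \<Phi> lam"

(* infdist x {} = 0 in the library, so nonemptiness must be required explicitly: an infimum of
   distances over the empty set would be infinite and no curve converges to {}. *)
definition converges_to_set :: "(real \<Rightarrow> real ^ 'n) \<Rightarrow> (real ^ 'n) set \<Rightarrow> bool" where
  "converges_to_set x X \<longleftrightarrow> X \<noteq> {} \<and> ((\<lambda>t. infdist (x t) X) \<longlongrightarrow> 0) at_top"

end

theory Submission
  imports Defs
begin

text \<open>
  With \<open>T\<close> the activation, \<open>E\<close> the energy and \<open>a = T u\<close>, the field is minus a subgradient of \<open>E\<close> at
  \<open>a\<close>, because \<open>u - a\<close> is a subgradient of the sparsity term \<open>lam \<parallel>\<cdot>\<parallel>\<^sub>1\<close> (restricted to the feasible set).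
  At the same time \<open>u\<close> is a subgradient at \<open>a\<close> of the strongly convex function
  \<open>\<Psi> a = \<parallel>a\<parallel>\<^sup>2 / 2 + lam \<parallel>a\<parallel>\<^sub>1\<close>. So the system is a mirror descent flow for \<open>E\<close> with mirror map
  \<open>T\<close>, and for every feasible \<open>c\<close> the Bregman distance from \<open>a\<close> to \<open>c\<close> (\<open>bregman\<close>) has derivative at
  most \<open>E c - E a\<close> along trajectories (\<open>bregman_dissipation\<close>). It is continuously differentiable in
  \<open>u\<close>, since the squared threshold is, although \<open>T\<close> and \<open>E \<circ> T\<close> have kinks on the thresholds. For an
  optimal \<open>c\<close> it is a Lyapunov function, and every part of the claim follows from it.

  Convergence (\<open>lca_solution_converges\<close>): the distance to an optimal point is nonnegative and
  nonincreasing, so trajectories are bounded and the energy comes arbitrarily close to its minimum.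
  A limit point \<open>v\<close> along suitable times has an optimal activation; the distance to \<open>T v\<close> tends to \<open>0\<close>
  along these times, hence along all times. So \<open>T (u t)\<close> converges to a single optimal point, and
  then \<open>u\<close> itself converges, since \<open>u' = - u + G (T u)\<close> for a continuous \<open>G\<close>.

  Invariance of the fixed region (\<open>positive_invariant_fixed_region\<close>): the distance to the optimal
  point \<open>T u0\<close> starts at \<open>0\<close> and stays there, so the activation never changes.

  Maximality (\<open>positive_invariant_subset_fixed_region\<close>): \<open>W\<close> is minus the sum of the squared field
  components over the active coordinates (\<open>lca_W_eq\<close>). Where \<open>W\<close> vanishes along a trajectory, active
  coordinates are at rest, so the activation is constant, and by convergence its value is optimal.

  The flow is well defined because the field is globally Lipschitz
  (\<open>lipschitz_ode_global_solution\<close>, \<open>lipschitz_ode_unique\<close>).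
\<close>

section \<open>Global solutions of Lipschitz differential equations\<close>

lemma nonincreasing_on_half_line:
  fixes f f' :: "real \<Rightarrow> real"
  assumes deriv: "\<And>t. 0 \<le> t \<Longrightarrow> (f has_real_derivative f' t) (at t within {0..})"
    and nonpos: "\<And>t. a \<le> t \<Longrightarrow> f' t \<le> 0"
    and "0 \<le> a" "a \<le> b"
  shows "f b \<le> f a"
proof (rule DERIV_nonpos_imp_decreasing_open[OF \<open>a \<le> b\<close>])
  fix t assume "a < t" "t < b"
  with \<open>0 \<le> a\<close> have "at t within {0..} = at t"
    by (intro at_within_interior) (simp add: interior_real_atLeast)
  with deriv[of t] \<open>0 \<le> a\<close> \<open>a < t\<close> have "DERIV f t :> f' t"
    by simp
  with nonpos[of t] \<open>0 \<le> a\<close> \<open>a < t\<close> show "\<exists>y. DERIV f t :> y \<and> y \<le> 0" by auto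
next
  have "continuous_on {0..} f"
    using deriv by (intro DERIV_continuous_on) auto
  then show "continuous_on {a..b} f"
    by (rule continuous_on_subset) (use \<open>0 \<le> a\<close> in auto)
qed

lemma integral_has_vector_derivative_half_line:
  fixes g :: "real \<Rightarrow> 'a::banach"
  assumes cont: "continuous_on {0..} g" and "0 \<le> t"
  shows "((\<lambda>t. integral {0..t} g) has_vector_derivative g t) (at t within {0..})"
proof -
  have "continuous_on {0..t + 1} g"
    by (rule continuous_on_subset[OF cont]) auto
  then have "((\<lambda>t. integral {0..t} g) has_vector_derivative g t) (at t within {0..t + 1})"
    using \<open>0 \<le> t\<close> by (intro integral_has_vector_derivative) auto
  moreover have "at t within {0..t + 1} = at t within {0..}"
    by (rule at_within_nhd[where S = "{..<t + 1}"]) (use \<open>0 \<le> t\<close> in auto)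
  ultimately show ?thesis by simp
qed

lemma norm_integral_le_exp:
  fixes g :: "real \<Rightarrow> 'a::banach"
  assumes cont: "continuous_on {0..} g" and "0 < k" "0 \<le> t" "0 \<le> C"
    and bound: "\<And>r. 0 \<le> r \<Longrightarrow> norm (g r) \<le> C * exp (k * r)"
  shows "norm (integral {0..t} g) \<le> C / k * exp (k * t)"
proof -
  have exp_int: "((\<lambda>r. C * exp (k * r)) has_integral (C / k * exp (k * t) - C / k * exp (k * 0))) {0..t}"
    using \<open>0 < k\<close> \<open>0 \<le> t\<close>
    by (intro fundamental_theorem_of_calculus)
      (auto intro!: derivative_eq_intros simp flip: has_real_derivative_iff_has_vector_derivative)
  have "norm (integral {0..t} g) \<le> integral {0..t} (\<lambda>r. C * exp (k * r))"
  proof (rule Henstock_Kurzweil_Integration.integral_norm_bound_integral)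
    show "g integrable_on {0..t}"
      by (rule integrable_continuous_real, rule continuous_on_subset[OF cont]) auto
  qed (use exp_int bound in auto)
  also have "\<dots> = C / k * exp (k * t) - C / k"
    using integral_unique[OF exp_int] by simp
  also have "\<dots> \<le> C / k * exp (k * t)"
    using \<open>0 < k\<close> \<open>0 \<le> C\<close> by simp
  finally show ?thesis .
qed

text \<open>A solution is a fixed point of the integral operator \<open>x \<mapsto> (t \<mapsto> x0 + \<integral>\<^sub>0\<^sup>t F (x r) dr)\<close>. The factor
  \<open>exp (- k t)\<close> with \<open>k = L + 1\<close> makes it a contraction on all of the half line at once: solutions
  grow at most like \<open>exp (k t)\<close>, so the rescaled ones are bounded, and integrating
  \<open>L exp (k r)\<close> and rescaling leaves the contraction constant \<open>L / k < 1\<close>.\<close>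
theorem lipschitz_ode_global_solution:
  fixes F :: "'a::banach \<Rightarrow> 'a"
  assumes lip: "L-lipschitz_on UNIV F"
  obtains x where "x 0 = x0"
    "\<And>t. 0 \<le> t \<Longrightarrow> (x has_vector_derivative F (x t)) (at t within {0..})"
proof -
  have L: "0 \<le> L" using lip by (rule lipschitz_on_nonneg)
  have norm_F: "norm (F v - F w) \<le> L * norm (v - w)" for v w
    using lipschitz_onD[OF lip] by (simp add: dist_norm)
  have cont_F: "continuous_on UNIV F"
    using lip by (rule lipschitz_on_continuous_on)
  define k where "k = L + 1"
  have "0 < k" using L by (simp add: k_def)
  \<comment> \<open>The unknown \<open>y\<close> stands for the rescaled solution \<open>exp (- k r) x r\<close>.\<close>
  define g where "g y r = F (exp (k * r) *\<^sub>R apply_bcontfun y r)" for y :: "real \<Rightarrow>\<^sub>C 'a" and r :: real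
  define J where "J y t = x0 + integral {0..t} (g y)" for y t
  have cont_g: "continuous_on {0..} (g y)" for y
    unfolding g_def by (intro continuous_on_compose2[OF cont_F] continuous_intros) auto
  have J_deriv: "(J y has_vector_derivative g y t) (at t within {0..})" if "0 \<le> t" for y t
    unfolding J_def using integral_has_vector_derivative_half_line[OF cont_g that, of y]
    by (auto intro!: derivative_eq_intros)
  have cont_J: "continuous_on {0..} (J y)" for y
    using J_deriv by (intro continuous_on_vector_derivative) auto
  \<comment> \<open>The rescaled integral operator, made constant on the negative half line.\<close>
  define Q where "Q y t = exp (- k * max 0 t) *\<^sub>R J y (max 0 t)" for y t
  have Q_bcontfun: "Q y \<in> bcontfun" for y
  proof -
    have "continuous_on UNIV (Q y)"
      unfolding Q_def by (intro continuous_intros continuous_on_compose2[OF cont_J]) auto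
    moreover have "norm (Q y t) \<le> norm x0 + (norm (F 0) + L * norm y) / k" for t
    proof -
      define \<tau> where "\<tau> = max 0 t"
      have "0 \<le> \<tau>" by (simp add: \<tau>_def)
      have "norm (g y r) \<le> (norm (F 0) + L * norm y) * exp (k * r)" if "0 \<le> r" for r
      proof -
        have "norm (g y r) \<le> norm (F 0) + norm (g y r - F 0)"
          by (metis add.commute diff_add_cancel norm_triangle_ineq)
        also have "norm (g y r - F 0) \<le> L * (exp (k * r) * norm (apply_bcontfun y r))"
          using norm_F[of "exp (k * r) *\<^sub>R apply_bcontfun y r" 0] by (simp add: g_def)
        also have "\<dots> \<le> L * (exp (k * r) * norm y)"
          using norm_bounded[of y r] L by (intro mult_left_mono) auto
        also have "norm (F 0) \<le> norm (F 0) * exp (k * r)"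
          using that \<open>0 < k\<close> by (simp add: mult_le_cancel_left1)
        finally show ?thesis by (simp add: algebra_simps)
      qed
      then have "norm (integral {0..\<tau>} (g y)) \<le> (norm (F 0) + L * norm y) / k * exp (k * \<tau>)"
        using \<open>0 < k\<close> \<open>0 \<le> \<tau>\<close> L by (intro norm_integral_le_exp[OF cont_g]) auto
      then have "norm (J y \<tau>) \<le> norm x0 + (norm (F 0) + L * norm y) / k * exp (k * \<tau>)"
        unfolding J_def by (intro order_trans[OF norm_triangle_ineq]) auto
      then have "norm (Q y t) \<le> exp (- k * \<tau>) * (norm x0 + (norm (F 0) + L * norm y) / k * exp (k * \<tau>))"
        by (simp add: Q_def \<tau>_def)
      also have "\<dots> = exp (- k * \<tau>) * norm x0 + (norm (F 0) + L * norm y) / k"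
        by (simp add: exp_minus field_simps)
      also have "exp (- k * \<tau>) * norm x0 \<le> norm x0"
        using \<open>0 < k\<close> \<open>0 \<le> \<tau>\<close> by (intro mult_left_le_one_le) auto
      finally show ?thesis by simp
    qed
    ultimately show ?thesis
      unfolding bcontfun_def bounded_iff by blast
  qed
  define P where "P y = Bcontfun (Q y)" for y
  have apply_P: "apply_bcontfun (P y) = Q y" for y
    unfolding P_def using Q_bcontfun by (rule Bcontfun_inverse)
  have "dist (P y) (P z) \<le> L / k * dist y z" for y z
  proof (rule dist_bound)
    fix t :: real
    define \<tau> where "\<tau> = max 0 t"
    have "0 \<le> \<tau>" by (simp add: \<tau>_def)
    have int: "g w integrable_on {0..\<tau>}" for w
      by (rule integrable_continuous_real, rule continuous_on_subset[OF cont_g]) auto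
    have "norm (g y r - g z r) \<le> L * dist y z * exp (k * r)" for r
    proof -
      have "norm (g y r - g z r)
          \<le> L * norm (exp (k * r) *\<^sub>R apply_bcontfun y r - exp (k * r) *\<^sub>R apply_bcontfun z r)"
        unfolding g_def by (rule norm_F)
      also have "\<dots> = L * (exp (k * r) * dist (apply_bcontfun y r) (apply_bcontfun z r))"
        by (simp add: dist_norm flip: scaleR_diff_right)
      also have "\<dots> \<le> L * (exp (k * r) * dist y z)"
        using L dist_bounded by (intro mult_left_mono) auto
      finally show ?thesis by (simp add: mult_ac)
    qed
    then have "norm (integral {0..\<tau>} (\<lambda>r. g y r - g z r)) \<le> L * dist y z / k * exp (k * \<tau>)"
      using \<open>0 < k\<close> \<open>0 \<le> \<tau>\<close> L
      by (intro norm_integral_le_exp) (auto intro: continuous_on_diff cont_g)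
    then have "norm (J y \<tau> - J z \<tau>) \<le> L * dist y z / k * exp (k * \<tau>)"
      by (simp add: J_def integral_diff int)
    then have "exp (- k * \<tau>) * norm (J y \<tau> - J z \<tau>)
        \<le> exp (- k * \<tau>) * (L * dist y z / k * exp (k * \<tau>))"
      by (intro mult_left_mono) auto
    then have "dist (Q y t) (Q z t) \<le> exp (- k * \<tau>) * (L * dist y z / k * exp (k * \<tau>))"
      by (simp add: Q_def \<tau>_def dist_norm[where 'a = 'a] flip: scaleR_diff_right)
    then show "dist (apply_bcontfun (P y) t) (apply_bcontfun (P z) t) \<le> L / k * dist y z"
      by (simp add: apply_P exp_minus field_simps)
  qed
  moreover have "0 \<le> L / k" "L / k < 1" using L by (auto simp: k_def)
  ultimately have "\<exists>!y. P y = y" by (intro banach_fix_type) auto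
  then obtain y where "P y = y" by blast
  then have y: "apply_bcontfun y t = Q y t" for t by (metis apply_P)
  have J_eq: "exp (k * t) *\<^sub>R apply_bcontfun y t = J y t" if "0 \<le> t" for t
    using that by (simp add: y Q_def flip: exp_add)
  show thesis
  proof
    show "J y 0 = x0" by (simp add: J_def)
    show "(J y has_vector_derivative F (J y t)) (at t within {0..})" if "0 \<le> t" for t
      using J_deriv[OF that, of y] by (simp add: g_def J_eq[OF that])
  qed
qed

text \<open>The squared distance of two solutions has derivative at most \<open>2 L\<close> times itself, so
  \<open>exp (- 2 L t) \<parallel>x t - y t\<parallel>\<^sup>2\<close> is nonincreasing; it starts at \<open>0\<close>.\<close>
theorem lipschitz_ode_unique:
  fixes F :: "'a::real_inner \<Rightarrow> 'a"
  assumes lip: "L-lipschitz_on UNIV F" and init: "x 0 = y 0" and "0 \<le> t"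
    and x: "\<And>t. 0 \<le> t \<Longrightarrow> (x has_vector_derivative F (x t)) (at t within {0..})"
    and y: "\<And>t. 0 \<le> t \<Longrightarrow> (y has_vector_derivative F (y t)) (at t within {0..})"
  shows "x t = y t"
proof -
  define q where "q t = exp (- 2 * L * t) * ((x t - y t) \<bullet> (x t - y t))" for t
  have "q t \<le> q 0"
  proof (rule nonincreasing_on_half_line[where f = q])
    fix t :: real assume "0 \<le> t"
    have xy: "((\<lambda>t. x t - y t) has_derivative (\<lambda>h. h *\<^sub>R (F (x t) - F (y t)))) (at t within {0..})"
      using has_vector_derivative_diff[OF x y] \<open>0 \<le> t\<close> by (simp add: has_vector_derivative_def)
    show "(q has_real_derivative 2 * exp (- 2 * L * t)
        * ((x t - y t) \<bullet> (F (x t) - F (y t)) - L * ((x t - y t) \<bullet> (x t - y t)))) (at t within {0..})"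
      unfolding q_def has_field_derivative_def
      by (rule derivative_eq_intros xy refl)+
        (auto simp: fun_eq_iff algebra_simps inner_commute)
    have "(x t - y t) \<bullet> (F (x t) - F (y t)) \<le> norm (x t - y t) * (L * norm (x t - y t))"
      using lipschitz_onD[OF lip, of "x t" "y t"]
      by (intro order_trans[OF norm_cauchy_schwarz] mult_left_mono) (auto simp: dist_norm)
    also have "\<dots> = L * ((x t - y t) \<bullet> (x t - y t))"
      by (simp add: power2_norm_eq_inner flip: power2_eq_square)
    finally show "2 * exp (- 2 * L * t)
        * ((x t - y t) \<bullet> (F (x t) - F (y t)) - L * ((x t - y t) \<bullet> (x t - y t))) \<le> 0"
      by (simp add: mult_nonneg_nonpos)
  qed (use \<open>0 \<le> t\<close> in auto)
  with init have "exp (- 2 * L * t) * ((x t - y t) \<bullet> (x t - y t)) \<le> 0" by (simp add: q_def)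
  then have "(x t - y t) \<bullet> (x t - y t) \<le> 0"
    by (simp add: mult_le_0_iff)
  with inner_ge_zero[of "x t - y t"] have "(x t - y t) \<bullet> (x t - y t) = 0"
    by (rule order_antisym[rotated])
  then show ?thesis by simp
qed

section \<open>Threshold functions and their potential\<close>

lemma has_real_derivative_of_quadratic_remainder:
  fixes f :: "real \<Rightarrow> real"
  assumes "\<And>y. \<bar>f y - f x - D * (y - x)\<bar> \<le> (y - x)\<^sup>2"
  shows "(f has_real_derivative D) (at x)"
proof -
  have "((\<lambda>y. (f y - f x) / (y - x) - D) \<longlongrightarrow> 0) (at x)"
  proof (rule Lim_null_comparison)
    have "norm ((f y - f x) / (y - x) - D) \<le> \<bar>y - x\<bar>" if "y \<noteq> x" for y
    proof -
      have "norm ((f y - f x) / (y - x) - D) = \<bar>f y - f x - D * (y - x)\<bar> / \<bar>y - x\<bar>"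
        using that by (simp add: diff_divide_distrib flip: abs_divide)
      also have "\<dots> \<le> (y - x)\<^sup>2 / \<bar>y - x\<bar>"
        by (intro divide_right_mono assms) auto
      also have "\<dots> = \<bar>y - x\<bar>"
        using that by (simp add: field_simps flip: power2_eq_square)
      finally show ?thesis .
    qed
    then show "\<forall>\<^sub>F y in at x. norm ((f y - f x) / (y - x) - D) \<le> \<bar>y - x\<bar>"
      by (auto simp: eventually_at_filter)
    have "((\<lambda>y. \<bar>y - x\<bar>) \<longlongrightarrow> \<bar>x - x\<bar>) (at x)"
      by (intro tendsto_intros)
    then show "((\<lambda>y. \<bar>y - x\<bar>) \<longlongrightarrow> 0) (at x)" by simp
  qed
  then show ?thesis
    by (simp add: has_field_derivative_iff LIM_zero_iff)
qed

lemma one_sided_threshold_nonneg: "0 \<le> one_sided_threshold lam x"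
  by (simp add: one_sided_threshold_def)

text \<open>The threshold function has a kink, but its square is continuously differentiable. This is what
  makes classical differentiation along a trajectory possible, where the activation itself is
  only Lipschitz.\<close>
lemma half_square_one_sided_threshold_deriv:
  "((\<lambda>x. (one_sided_threshold lam x)\<^sup>2 / 2) has_real_derivative one_sided_threshold lam x) (at x)"
proof (rule has_real_derivative_of_quadratic_remainder)
  fix y
  have quad: "\<bar>v\<^sup>2 / 2 - w\<^sup>2 / 2 - w * (v - w)\<bar> \<le> (v - w)\<^sup>2" for v w :: real
  proof -
    have "v\<^sup>2 / 2 - w\<^sup>2 / 2 - w * (v - w) = (v - w)\<^sup>2 / 2"
      by (simp add: power2_eq_square field_simps)
    then show ?thesis by (simp only: abs_divide) simp
  qed
  have mixed: "\<bar>- (w\<^sup>2 / 2) - w * v\<bar> \<le> v\<^sup>2" if "0 < w" "v \<le> - w" for v w :: real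
  proof -
    have "w * w \<le> w * (- v)" "w * (- v) \<le> (- v) * (- v)"
      using that by (intro mult_left_mono mult_right_mono; simp)+
    with zero_le_square[of w] show ?thesis
      unfolding power2_eq_square abs_le_iff by linarith
  qed
  have neg: "(y - lam)\<^sup>2 / 2 \<le> (y - x)\<^sup>2" if "lam < y" "x \<le> lam"
  proof -
    have "(y - lam)\<^sup>2 \<le> (y - x)\<^sup>2" using that by (intro power_mono) auto
    then show ?thesis by (smt (verit) field_sum_of_halves zero_le_power2)
  qed
  show "\<bar>(one_sided_threshold lam y)\<^sup>2 / 2 - (one_sided_threshold lam x)\<^sup>2 / 2
      - one_sided_threshold lam x * (y - x)\<bar> \<le> (y - x)\<^sup>2"
    using quad[of "y - lam" "x - lam"] mixed[of "x - lam" "y - x"] neg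
    by (auto simp: one_sided_threshold_def)
qed

lemma half_square_threshold_deriv:
  assumes "0 \<le> lam"
  shows "((\<lambda>x. (threshold p lam x)\<^sup>2 / 2) has_real_derivative threshold p lam x) (at x)"
proof (cases p)
  case LASSO
  have "((\<lambda>x. (one_sided_threshold lam (- x))\<^sup>2 / 2)
      has_real_derivative one_sided_threshold lam (- x) * (- 1)) (at x)"
    by (rule DERIV_chain2[OF half_square_one_sided_threshold_deriv]) (auto intro!: derivative_eq_intros)
  from DERIV_add[OF half_square_one_sided_threshold_deriv this]
  have "((\<lambda>x. (one_sided_threshold lam x)\<^sup>2 / 2 + (one_sided_threshold lam (- x))\<^sup>2 / 2)
      has_real_derivative threshold p lam x) (at x)"
    by (simp add: LASSO)
  \<comment> \<open>The two one-sided thresholds are never nonzero together, so squaring leaves no cross term.\<close>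
  moreover have "(one_sided_threshold lam x)\<^sup>2 / 2 + (one_sided_threshold lam (- x))\<^sup>2 / 2
      = (threshold p lam x)\<^sup>2 / 2" for x
    using assms by (simp add: LASSO one_sided_threshold_def power2_eq_square algebra_simps)
  ultimately show ?thesis by simp
next
  case CLASSO
  then show ?thesis using half_square_one_sided_threshold_deriv by simp
qed

lemma threshold_nonexpansive:
  assumes "0 \<le> lam"
  shows "\<bar>threshold p lam x - threshold p lam y\<bar> \<le> \<bar>x - y\<bar>"
  using assms by (cases p) (auto simp: one_sided_threshold_def)

text \<open>This lemma and the next one together say that the residual \<open>x - T x\<close> is a subgradient at \<open>T x\<close> of
  \<open>lam \<bar>\<cdot>\<bar>\<close>, restricted to the nonnegative reals for CLASSO: subtracting them gives
  \<open>(x - T x) (c - T x) \<le> lam \<bar>c\<bar> - lam \<bar>T x\<bar>\<close>.\<close>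
lemma threshold_residual_times_threshold:
  assumes "0 \<le> lam"
  shows "(x - threshold p lam x) * threshold p lam x = lam * \<bar>threshold p lam x\<bar>"
  using assms by (cases p) (auto simp: one_sided_threshold_def algebra_simps)

lemma threshold_residual_times_le:
  assumes "0 \<le> lam" and "p = CLASSO \<Longrightarrow> 0 \<le> c"
  shows "(x - threshold p lam x) * c \<le> lam * \<bar>c\<bar>"
proof (cases p)
  case LASSO
  have "\<bar>x - threshold p lam x\<bar> \<le> lam"
    using assms(1) by (auto simp: LASSO one_sided_threshold_def)
  then have "\<bar>x - threshold p lam x\<bar> * \<bar>c\<bar> \<le> lam * \<bar>c\<bar>"
    by (rule mult_right_mono) simp
  then show ?thesis by (metis abs_ge_self abs_mult order_trans)
next
  case CLASSO
  then have "x - threshold p lam x \<le> lam" "0 \<le> c"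
    using assms(2) by (auto simp: one_sided_threshold_def)
  then show ?thesis by (simp add: mult_right_mono)
qed

lemma threshold_residual_active:
  assumes "0 \<le> lam" "threshold p lam x \<noteq> 0"
  shows "x - threshold p lam x = lam * sgn (threshold p lam x)"
  using assms by (cases p) (auto simp: one_sided_threshold_def split: if_splits)

lemma threshold_translate_near_active:
  assumes "0 \<le> lam" "threshold p lam x \<noteq> 0"
  shows "\<forall>\<^sub>F h in nhds 0. threshold p lam (x + h) = threshold p lam x + h"
proof -
  have small: "\<forall>\<^sub>F h in nhds 0. \<bar>h\<bar> < \<epsilon>" if "0 < \<epsilon>" for \<epsilon> :: real
    using that by (auto simp: eventually_nhds_metric dist_real_def)
  have "\<forall>\<^sub>F h in nhds 0. \<bar>h\<bar> < \<bar>threshold p lam x\<bar>"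
    using assms(2) by (intro small) simp
  then show ?thesis
    by eventually_elim (use assms in \<open>cases p; auto simp: one_sided_threshold_def split: if_splits\<close>)
qed

section \<open>The vector field, the energy and the function W\<close>

lemma activation_nth [simp]: "activation p lam u $ n = threshold p lam (u $ n)"
  by (simp add: activation_def)

lemma feasible_nth_nonneg: "c \<in> feasible p \<Longrightarrow> p = CLASSO \<Longrightarrow> 0 \<le> c $ n"
  by simp

lemma activation_feasible: "activation p lam u \<in> feasible p"
  by (cases p) (auto simp: one_sided_threshold_nonneg)

lemma closed_feasible: "closed (feasible p)"
  by (cases p) (auto simp: Collect_all_eq intro!: closed_INT closed_Collect_le continuous_intros)

lemma activation_lipschitz:
  assumes "0 \<le> lam"
  shows "1-lipschitz_on UNIV (activation p lam)"
proof (rule lipschitz_onI)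
  fix u v :: "real ^ 'n"
  show "dist (activation p lam u) (activation p lam v) \<le> 1 * dist u v"
    unfolding dist_norm using threshold_nonexpansive[OF assms]
    by (simp add: norm_le_componentwise_cart)
qed simp

text \<open>A gradient step of unit length on \<open>a \<mapsto> \<parallel>s - \<Phi> a\<parallel>\<^sup>2 / 2\<close>; it isolates the part of the
  field that sees \<open>u\<close> only through its activation.\<close>
definition gradient_step :: "real ^ 'm \<Rightarrow> real ^ 'n ^ 'm \<Rightarrow> real ^ 'n \<Rightarrow> real ^ 'n" where
  "gradient_step s \<Phi> a = transpose \<Phi> *v (s - \<Phi> *v a) + a"

lemma continuous_on_gradient_step: "continuous_on S (gradient_step s \<Phi>)"
  unfolding gradient_step_def
  by (intro continuous_intros continuous_on_compose2[OF matrix_vector_mult_linear_continuous_on]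
      matrix_vector_mult_linear_continuous_on) auto

lemma lca_field_eq:
  "lca_field p s \<Phi> lam u = gradient_step s \<Phi> (activation p lam u) - u"
  by (simp add: lca_field_def gradient_step_def matrix_vector_mult_diff_distrib matrix_vector_mult_diff_rdistrib
      matrix_vector_mul_assoc)

lemma lca_field_lipschitz:
  fixes s :: "real ^ 'm" and \<Phi> :: "real ^ 'n ^ 'm"
  assumes "0 \<le> lam"
  obtains L where "L-lipschitz_on UNIV (lca_field p s \<Phi> lam)"
proof -
  obtain K where K: "K-lipschitz_on UNIV ((*v) (transpose \<Phi> ** \<Phi> - mat 1))"
    using bounded_linear.lipschitz_boundE[OF matrix_vector_mul_bounded_linear] by blast
  have "K-lipschitz_on (range (activation p lam)) ((*v) (transpose \<Phi> ** \<Phi> - mat 1))"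
    by (rule lipschitz_on_subset[OF K]) simp
  from lipschitz_on_compose2[OF activation_lipschitz[OF assms] this]
  have "(0 + 1 + K * 1)-lipschitz_on UNIV (lca_field p s \<Phi> lam)"
    unfolding lca_field_def
    by (intro lipschitz_on_diff lipschitz_on_constant lipschitz_on_id) auto
  then show thesis by (rule that)
qed

lemma continuous_on_energy: "continuous_on S (energy s \<Phi> lam)"
  unfolding energy_def by (intro continuous_intros matrix_vector_mult_linear_continuous_on)

lemma energy_coercive:
  assumes "0 \<le> lam"
  shows "lam * norm a \<le> energy s \<Phi> lam a"
proof -
  have "lam * norm a \<le> lam * (\<Sum>n\<in>UNIV. \<bar>a $ n\<bar>)"
    using assms by (intro mult_left_mono norm_le_l1_cart)
  also have "\<dots> \<le> energy s \<Phi> lam a" by (simp add: energy_def)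
  finally show ?thesis .
qed

text \<open>Outside the ball of radius \<open>E 0 / lam\<close> the energy exceeds its value at \<open>0\<close>, so it suffices to
  minimize over a compact set.\<close>
lemma optimal_solutions_nonempty:
  fixes s :: "real ^ 'm" and \<Phi> :: "real ^ 'n ^ 'm"
  assumes "0 < lam"
  shows "optimal_solutions p s \<Phi> lam \<noteq> {}"
proof -
  let ?E = "energy s \<Phi> lam"
  let ?K = "feasible p \<inter> cball 0 (?E 0 / lam)"
  have "compact ?K" by (intro closed_Int_compact closed_feasible) simp
  moreover have zero: "0 \<in> ?K"
    using energy_coercive[of lam 0 s \<Phi>] assms by (cases p) auto
  ultimately obtain c where c: "c \<in> ?K" "\<And>a. a \<in> ?K \<Longrightarrow> ?E c \<le> ?E a"
    using continuous_attains_inf[OF _ _ continuous_on_energy, of ?K] by blast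
  have "?E c \<le> ?E a" if "a \<in> feasible p" for a
  proof (cases "a \<in> ?K")
    case False
    then have "?E 0 < lam * norm a"
      using that assms by (simp add: field_simps)
    also have "\<dots> \<le> ?E a" using assms by (intro energy_coercive) simp
    finally show ?thesis using c(2)[OF zero] by simp
  qed (use c in auto)
  with c(1) show ?thesis by (auto simp: optimal_solutions_def)
qed

text \<open>Along an active coordinate the activation moves with \<open>u\<close> at unit speed, so the partial derivative is
  that of the energy, and \<open>lam sgn (a\<^sub>n)\<close> is precisely the residual \<open>u\<^sub>n - a\<^sub>n\<close> in the field.\<close>
lemma partial_deriv_lca_V_active:
  fixes s :: "real ^ 'm" and \<Phi> :: "real ^ 'n ^ 'm"
  assumes "0 \<le> lam" and n: "n \<in> active (activation p lam u)"
  shows "partial_deriv (lca_V p s \<Phi> lam) n u = - lca_field p s \<Phi> lam u $ n"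
proof -
  define a where "a = activation p lam u"
  define r where "r = s - \<Phi> *v a"
  define \<psi> where "\<psi> = \<Phi> *v axis n 1"
  have an: "a $ n \<noteq> 0" using n by (simp add: active_def a_def)
  then have thr: "threshold p lam (u $ n) \<noteq> 0" by (simp add: a_def)
  have pair: "\<psi> \<bullet> w = (transpose \<Phi> *v w) $ n" for w
    using dot_lmul_matrix[of w \<Phi> "axis n 1"]
    by (simp add: \<psi>_def inner_commute[of _ w] inner_axis transpose_matrix_vector)
  have deriv: "((\<lambda>h. 1 / 2 * (norm (r - h *\<^sub>R \<psi>))\<^sup>2
        + lam * (\<Sum>m\<in>UNIV. \<bar>a $ m + h * axis n 1 $ m\<bar>))
      has_real_derivative - (\<psi> \<bullet> r) + lam * sgn (a $ n)) (at 0)"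
  proof -
    have abs: "((\<lambda>h. \<bar>a $ m + h * axis n 1 $ m\<bar>)
        has_real_derivative (if m = n then sgn (a $ n) else 0)) (at 0)" for m
    proof (cases "m = n")
      case True
      have "(abs has_real_derivative sgn (a $ n)) (at (a $ n))"
      proof (rule DERIV_cong_ev[THEN iffD1, OF refl _ refl])
        show "((\<lambda>x. sgn (a $ n) * x) has_real_derivative sgn (a $ n)) (at (a $ n))"
          by (auto intro!: derivative_eq_intros)
        have "\<forall>\<^sub>F x in nhds (a $ n). \<bar>x - a $ n\<bar> < \<bar>a $ n\<bar>"
          using an by (auto simp: eventually_nhds_metric dist_real_def intro!: exI[of _ "\<bar>a $ n\<bar>"])
        then show "\<forall>\<^sub>F x in nhds (a $ n). sgn (a $ n) * x = \<bar>x\<bar>"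
          by eventually_elim (auto simp: sgn_if)
      qed
      with True show ?thesis
        by (simp add: add.commute DERIV_shift[of abs _ 0 "a $ n", simplified])
    qed (simp add: axis_def)
    have "1 / 2 * (norm (r - h *\<^sub>R \<psi>))\<^sup>2 = (r \<bullet> r - 2 * h * (\<psi> \<bullet> r) + h\<^sup>2 * (\<psi> \<bullet> \<psi>)) / 2" for h
      unfolding power2_norm_eq_inner
      by (simp add: inner_diff_left inner_diff_right inner_commute power2_eq_square)
    then show ?thesis
      by (auto intro!: derivative_eq_intros abs)
  qed
  have ev: "\<forall>\<^sub>F h in nhds 0. lca_V p s \<Phi> lam (u + h *\<^sub>R axis n 1)
      = 1 / 2 * (norm (r - h *\<^sub>R \<psi>))\<^sup>2 + lam * (\<Sum>m\<in>UNIV. \<bar>a $ m + h * axis n 1 $ m\<bar>)"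
    using threshold_translate_near_active[OF assms(1) thr]
  proof eventually_elim
    case (elim h)
    then have "activation p lam (u + h *\<^sub>R axis n 1) = a + h *\<^sub>R axis n 1"
      by (auto simp: vec_eq_iff a_def axis_def)
    then show ?case
      by (simp add: lca_V_def energy_def r_def \<psi>_def matrix_vector_right_distrib
          matrix_vector_mult_scaleR diff_diff_eq)
  qed
  have "((\<lambda>h. lca_V p s \<Phi> lam (u + h *\<^sub>R axis n 1))
      has_real_derivative - (\<psi> \<bullet> r) + lam * sgn (a $ n)) (at 0)"
    by (rule DERIV_cong_ev[OF refl ev refl, THEN iffD2, OF deriv])
  then have "partial_deriv (lca_V p s \<Phi> lam) n u = - (\<psi> \<bullet> r) + lam * sgn (a $ n)"
    unfolding partial_deriv_def by (rule DERIV_imp_deriv)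
  also have "lam * sgn (a $ n) = u $ n - a $ n"
    using threshold_residual_active[OF assms(1) thr] by (simp add: a_def)
  finally show ?thesis
    by (simp add: lca_field_eq gradient_step_def pair r_def a_def)
qed

lemma lca_W_eq:
  assumes "0 \<le> lam"
  shows "lca_W p s \<Phi> lam u = - (\<Sum>n\<in>active (activation p lam u). (lca_field p s \<Phi> lam u $ n)\<^sup>2)"
proof -
  have "(\<Sum>n\<in>active (activation p lam u).
          partial_deriv (lca_V p s \<Phi> lam) n u * lca_field p s \<Phi> lam u $ n)
      = (\<Sum>n\<in>active (activation p lam u). - (lca_field p s \<Phi> lam u $ n)\<^sup>2)"
    by (intro sum.cong) (simp_all add: partial_deriv_lca_V_active assms power2_eq_square)
  then show ?thesis by (simp add: lca_W_def sum_negf)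
qed

lemma lca_W_eq_zero_iff:
  assumes "0 \<le> lam"
  shows "lca_W p s \<Phi> lam u = 0 \<longleftrightarrow>
    (\<forall>n\<in>active (activation p lam u). lca_field p s \<Phi> lam u $ n = 0)"
  by (simp add: lca_W_eq assms sum_nonneg_eq_0_iff)

section \<open>A Bregman distance as Lyapunov function\<close>

text \<open>Let \<open>\<Psi> a = \<parallel>a\<parallel>\<^sup>2 / 2 + lam \<parallel>a\<parallel>\<^sub>1\<close> on the feasible set. Its convex conjugate is
  \<open>u \<mapsto> \<parallel>T u\<parallel>\<^sup>2 / 2\<close>, with gradient \<open>T\<close>, and for feasible \<open>c\<close> this is the Fenchel-Young gap
  \<open>\<Psi>\<^sup>* u + \<Psi> c - \<langle>u, c\<rangle>\<close>, that is, the Bregman distance from \<open>T u\<close> to \<open>c\<close> with respect to the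
  subgradient \<open>u\<close> of \<open>\<Psi>\<close> at \<open>T u\<close>. Writing it through \<open>\<Psi>\<^sup>*\<close> makes it continuously differentiable
  in \<open>u\<close>.\<close>
definition bregman :: "lca_problem \<Rightarrow> real \<Rightarrow> real ^ 'n \<Rightarrow> real ^ 'n \<Rightarrow> real" where
  "bregman p lam c u = (\<Sum>n\<in>UNIV. (threshold p lam (u $ n))\<^sup>2 / 2
     + ((c $ n)\<^sup>2 / 2 + lam * \<bar>c $ n\<bar>) - u $ n * c $ n)"

text \<open>The quadratic part of \<open>\<Psi>\<close> makes it strongly convex with modulus \<open>1\<close>.\<close>
lemma half_norm_square_le_bregman:
  assumes "0 \<le> lam" "c \<in> feasible p"
  shows "(norm (c - activation p lam u))\<^sup>2 / 2 \<le> bregman p lam c u"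
proof -
  have "(norm (c - activation p lam u))\<^sup>2 / 2 = (\<Sum>n\<in>UNIV. (c $ n - threshold p lam (u $ n))\<^sup>2 / 2)"
    by (simp only: power2_norm_eq_inner inner_vec_def sum_divide_distrib)
      (simp add: power2_eq_square)
  also have "\<dots> \<le> bregman p lam c u"
    unfolding bregman_def
  proof (rule sum_mono)
    fix n
    show "(c $ n - threshold p lam (u $ n))\<^sup>2 / 2 \<le> (threshold p lam (u $ n))\<^sup>2 / 2
        + ((c $ n)\<^sup>2 / 2 + lam * \<bar>c $ n\<bar>) - u $ n * c $ n"
      using threshold_residual_times_le[where p = p and x = "u $ n" and c = "c $ n",
            OF assms(1) feasible_nth_nonneg[OF assms(2)]]
      by (simp add: power2_eq_square field_simps)
  qed
  finally show ?thesis .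
qed

text \<open>The point \<open>u\<close> is a subgradient of \<open>\<Psi>\<close> at \<open>T u\<close>, so the Fenchel-Young inequality is an equality.\<close>
lemma bregman_activation_self:
  assumes "0 \<le> lam"
  shows "bregman p lam (activation p lam u) u = 0"
  unfolding bregman_def
proof (rule sum.neutral, rule ballI)
  fix n
  show "(threshold p lam (u $ n))\<^sup>2 / 2 + ((activation p lam u $ n)\<^sup>2 / 2
      + lam * \<bar>activation p lam u $ n\<bar>) - u $ n * activation p lam u $ n = 0"
    using threshold_residual_times_threshold[OF assms, of "u $ n" p]
    by (simp add: power2_eq_square algebra_simps)
qed

lemma continuous_on_threshold:
  assumes "0 \<le> lam"
  shows "continuous_on S (threshold p lam)"
proof -
  have "1-lipschitz_on S (threshold p lam)"
    using threshold_nonexpansive[OF assms] by (intro lipschitz_onI) (auto simp: dist_real_def)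
  then show ?thesis by (rule lipschitz_on_continuous_on)
qed

lemma continuous_on_bregman:
  assumes "0 \<le> lam"
  shows "continuous_on S (bregman p lam c)"
  unfolding bregman_def
  by (intro continuous_intros continuous_on_compose2[OF continuous_on_threshold[OF assms]]) auto

text \<open>The left-hand side is the derivative of \<open>bregman p lam c\<close> along the field. The field is minus a
  subgradient of the energy at \<open>a\<close>: the smooth part contributes the gradient of the quadratic term,
  and \<open>u - a\<close> is a subgradient of the sparsity term. The bound is the subgradient inequality.\<close>
lemma bregman_dissipation:
  fixes s :: "real ^ 'm" and \<Phi> :: "real ^ 'n ^ 'm" and u :: "real ^ 'n"
  assumes "0 \<le> lam" "c \<in> feasible p"
  defines "a \<equiv> activation p lam u"
  shows "(a - c) \<bullet> lca_field p s \<Phi> lam u \<le> energy s \<Phi> lam c - energy s \<Phi> lam a"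
proof -
  define r where "r = s - \<Phi> *v a"
  define q where "q = \<Phi> *v (a - c)"
  have "(a - c) \<bullet> (transpose \<Phi> *v r) = q \<bullet> r"
    using dot_lmul_matrix[of r \<Phi> "a - c"]
    by (simp add: q_def inner_commute transpose_matrix_vector)
  moreover have "(norm (s - \<Phi> *v c))\<^sup>2 = (norm r)\<^sup>2 + 2 * (q \<bullet> r) + (norm q)\<^sup>2"
  proof -
    have "s - \<Phi> *v c = r + q"
      by (simp add: r_def q_def matrix_vector_mult_diff_distrib)
    then show ?thesis
      by (simp add: power2_norm_eq_inner inner_add_left inner_add_right inner_commute)
  qed
  moreover have "(a - c) \<bullet> (a - u) \<le> lam * (\<Sum>n\<in>UNIV. \<bar>c $ n\<bar>) - lam * (\<Sum>n\<in>UNIV. \<bar>a $ n\<bar>)"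
  proof -
    have "(a - c) \<bullet> (a - u) \<le> (\<Sum>n\<in>UNIV. lam * \<bar>c $ n\<bar> - lam * \<bar>a $ n\<bar>)"
      unfolding inner_vec_def
    proof (rule sum_mono)
      fix n
      show "(a - c) $ n \<bullet> (a - u) $ n \<le> lam * \<bar>c $ n\<bar> - lam * \<bar>a $ n\<bar>"
        using threshold_residual_times_le[where p = p and x = "u $ n" and c = "c $ n",
            OF assms(1) feasible_nth_nonneg[OF assms(2)]]
          threshold_residual_times_threshold[OF assms(1), of "u $ n" p]
        by (simp add: a_def algebra_simps)
    qed
    then show ?thesis by (simp add: sum_subtractf sum_distrib_left)
  qed
  moreover have "(a - c) \<bullet> lca_field p s \<Phi> lam u
      = (a - c) \<bullet> (transpose \<Phi> *v r) + (a - c) \<bullet> (a - u)"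
    by (simp add: lca_field_eq gradient_step_def r_def a_def flip: inner_add_right add_diff_eq)
  moreover have "0 \<le> (norm q)\<^sup>2" by simp
  ultimately show ?thesis unfolding energy_def r_def[symmetric] by argo
qed

section \<open>The scalar equation x' = c(t) - x\<close>

text \<open>The function \<open>exp t (x t - C)\<close> has derivative \<open>exp t (c t - C)\<close>, so it is nonincreasing from \<open>t0\<close> on.\<close>
lemma relaxation_upper_bound:
  fixes x c :: "real \<Rightarrow> real"
  assumes x: "\<And>t. 0 \<le> t \<Longrightarrow> (x has_real_derivative c t - x t) (at t within {0..})"
    and c: "\<And>t. t0 \<le> t \<Longrightarrow> c t \<le> C" and "0 \<le> t0" "t0 \<le> t"
  shows "x t \<le> C + exp (t0 - t) * (x t0 - C)"
proof -
  define q where "q t = exp t * (x t - C)" for t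
  have "q t \<le> q t0"
  proof (rule nonincreasing_on_half_line[where f = q])
    fix t :: real assume "0 \<le> t"
    then show "(q has_real_derivative exp t * (c t - C)) (at t within {0..})"
      unfolding q_def by (auto intro!: derivative_eq_intros x simp: algebra_simps)
  next
    fix t assume "t0 \<le> t"
    then show "exp t * (c t - C) \<le> 0"
      using c[of t] by (simp add: mult_nonneg_nonpos)
  qed (use assms in auto)
  then have "exp (- t) * (exp t * (x t - C)) \<le> exp (- t) * (exp t0 * (x t0 - C))"
    unfolding q_def by (intro mult_left_mono) auto
  then have "x t - C \<le> exp (t0 - t) * (x t0 - C)"
    by (simp flip: mult.assoc exp_add)
  then show ?thesis by simp
qed

lemma relaxation_bound:
  fixes x c :: "real \<Rightarrow> real"
  assumes x: "\<And>t. 0 \<le> t \<Longrightarrow> (x has_real_derivative c t - x t) (at t within {0..})"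
    and c: "\<And>t. t0 \<le> t \<Longrightarrow> \<bar>c t - l\<bar> \<le> C" and "0 \<le> t0" "t0 \<le> t" "0 \<le> C"
  shows "\<bar>x t - l\<bar> \<le> C + exp (t0 - t) * \<bar>x t0 - l\<bar>"
proof -
  have "x t \<le> (C + l) + exp (t0 - t) * (x t0 - (C + l))"
    by (rule relaxation_upper_bound[OF x]) (use c \<open>0 \<le> t0\<close> \<open>t0 \<le> t\<close> in \<open>fastforce simp: abs_le_iff\<close>)+
  moreover have "- x t \<le> (C - l) + exp (t0 - t) * (- x t0 - (C - l))"
  proof (rule relaxation_upper_bound[where x = "\<lambda>t. - x t" and c = "\<lambda>t. - c t"])
    show "((\<lambda>t. - x t) has_real_derivative - c t - - x t) (at t within {0..})" if "0 \<le> t" for t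
      using DERIV_minus[OF x[OF that]] by simp
    show "- c t \<le> C - l" if "t0 \<le> t" for t
      using c[OF that] by (simp add: abs_le_iff)
  qed fact+
  moreover have "exp (t0 - t) * (x t0 - (C + l)) \<le> exp (t0 - t) * \<bar>x t0 - l\<bar>"
    "exp (t0 - t) * (- x t0 - (C - l)) \<le> exp (t0 - t) * \<bar>x t0 - l\<bar>"
    using \<open>0 \<le> C\<close> by (intro mult_left_mono; simp)+
  ultimately show ?thesis unfolding abs_le_iff by linarith
qed

lemma relaxation_tendsto:
  fixes x c :: "real \<Rightarrow> real"
  assumes x: "\<And>t. 0 \<le> t \<Longrightarrow> (x has_real_derivative c t - x t) (at t within {0..})"
    and c: "(c \<longlongrightarrow> l) at_top"
  shows "(x \<longlongrightarrow> l) at_top"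
proof (rule tendstoI)
  fix \<epsilon> :: real assume "0 < \<epsilon>"
  then have "\<forall>\<^sub>F t in at_top. dist (c t) l < \<epsilon> / 2" by (intro tendstoD[OF c]) simp
  then obtain t1 where t1: "\<And>t. t1 \<le> t \<Longrightarrow> \<bar>c t - l\<bar> < \<epsilon> / 2"
    by (auto simp: eventually_at_top_linorder dist_real_def)
  define t0 where "t0 = max 0 t1"
  have "((\<lambda>t. exp (- t) * (exp t0 * \<bar>x t0 - l\<bar>)) \<longlongrightarrow> 0 * (exp t0 * \<bar>x t0 - l\<bar>)) at_top"
    by (intro tendsto_mult tendsto_const filterlim_compose[OF exp_at_bot filterlim_uminus_at_bot_at_top])
  then have "\<forall>\<^sub>F t in at_top. exp (- t) * (exp t0 * \<bar>x t0 - l\<bar>) < \<epsilon> / 2"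
    using \<open>0 < \<epsilon>\<close> by (intro order_tendstoD(2)) auto
  with eventually_ge_at_top[of t0] show "\<forall>\<^sub>F t in at_top. dist (x t) l < \<epsilon>"
  proof eventually_elim
    case (elim t)
    have "\<bar>x t - l\<bar> \<le> \<epsilon> / 2 + exp (t0 - t) * \<bar>x t0 - l\<bar>"
      using t1 \<open>0 < \<epsilon>\<close> elim
      by (intro relaxation_bound[OF x]) (auto simp: t0_def intro: less_imp_le)
    also have "exp (t0 - t) = exp (- t) * exp t0" by (simp flip: exp_add)
    finally show ?case using elim by (simp add: dist_real_def mult.assoc)
  qed
qed

section \<open>Trajectories of the system\<close>

lemma lca_solution_exists:
  assumes "0 \<le> lam"
  obtains u where "lca_solution p s \<Phi> lam u0 u"
proof -
  obtain L where "L-lipschitz_on UNIV (lca_field p s \<Phi> lam)"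
    using lca_field_lipschitz[OF assms] .
  from lipschitz_ode_global_solution[OF this, of u0] show thesis
    using that unfolding lca_solution_def by metis
qed

lemma lca_flow_eq_solution:
  assumes "0 \<le> lam" and u: "lca_solution p s \<Phi> lam u0 u" and "0 \<le> t"
  shows "lca_flow p s \<Phi> lam t u0 = u t"
  unfolding lca_flow_def
proof (rule the_equality)
  obtain L where L: "L-lipschitz_on UNIV (lca_field p s \<Phi> lam)"
    using lca_field_lipschitz[OF assms(1)] .
  fix x assume "\<exists>v. lca_solution p s \<Phi> lam u0 v \<and> x = v t"
  then obtain v where v: "lca_solution p s \<Phi> lam u0 v" "x = v t" by blast
  have "v t = u t"
    by (rule lipschitz_ode_unique[OF L]) (use u v \<open>0 \<le> t\<close> in \<open>auto simp: lca_solution_def\<close>)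
  with v show "x = u t" by simp
qed (use u in blast)

lemma lca_solution_nth_deriv:
  assumes "lca_solution p s \<Phi> lam u0 u" "0 \<le> t"
  shows "((\<lambda>t. u t $ n) has_real_derivative lca_field p s \<Phi> lam (u t) $ n) (at t within {0..})"
proof -
  have "(u has_vector_derivative lca_field p s \<Phi> lam (u t)) (at t within {0..})"
    using assms by (simp add: lca_solution_def)
  from bounded_linear.has_vector_derivative[OF bounded_linear_vec_nth this] show ?thesis
    by (simp add: has_real_derivative_iff_has_vector_derivative)
qed

lemma bregman_along_solution_deriv:
  assumes "0 \<le> lam" and u: "lca_solution p s \<Phi> lam u0 u" and "0 \<le> t"
  shows "((\<lambda>t. bregman p lam c (u t)) has_real_derivative
      (activation p lam (u t) - c) \<bullet> lca_field p s \<Phi> lam (u t)) (at t within {0..})"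
proof -
  have sq: "((\<lambda>t. (threshold p lam (u t $ n))\<^sup>2 / 2) has_real_derivative
      threshold p lam (u t $ n) * lca_field p s \<Phi> lam (u t) $ n) (at t within {0..})" for n
    by (rule DERIV_chain2[OF half_square_threshold_deriv[OF assms(1)] lca_solution_nth_deriv[OF u \<open>0 \<le> t\<close>]])
  have "((\<lambda>t. (threshold p lam (u t $ n))\<^sup>2 / 2 + ((c $ n)\<^sup>2 / 2 + lam * \<bar>c $ n\<bar>) - u t $ n * c $ n)
      has_real_derivative (activation p lam (u t) - c) $ n \<bullet> lca_field p s \<Phi> lam (u t) $ n)
      (at t within {0..})" for n
    by (rule derivative_eq_intros sq lca_solution_nth_deriv[OF u \<open>0 \<le> t\<close>] refl)+
      (simp add: algebra_simps)
  then show ?thesis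
    unfolding bregman_def inner_vec_def by (intro DERIV_sum)
qed

lemma bregman_along_solution_nonincreasing:
  assumes "0 \<le> lam" and u: "lca_solution p s \<Phi> lam u0 u"
    and c: "c \<in> optimal_solutions p s \<Phi> lam" and "0 \<le> t1" "t1 \<le> t2"
  shows "bregman p lam c (u t2) \<le> bregman p lam c (u t1)"
proof (rule nonincreasing_on_half_line[OF bregman_along_solution_deriv[OF assms(1) u]])
  fix t
  show "(activation p lam (u t) - c) \<bullet> lca_field p s \<Phi> lam (u t) \<le> 0"
    using bregman_dissipation[OF assms(1), of c p "u t" s \<Phi>] c activation_feasible[of p lam "u t"]
    by (fastforce simp: optimal_solutions_def)
qed (use assms in auto)

text \<open>The Bregman distance to the optimal point \<open>T u0\<close> is zero at time \<open>0\<close> and nonincreasing, hence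
  zero forever, and it dominates \<open>\<parallel>T u0 - T (u t)\<parallel>\<^sup>2 / 2\<close>.\<close>
lemma activation_fixed_along_solution_from_fixed_region:
  assumes "0 \<le> lam" and u: "lca_solution p s \<Phi> lam u0 u"
    and u0: "u0 \<in> fixed_region p s \<Phi> lam" and "0 \<le> t"
  shows "activation p lam (u t) = activation p lam u0"
proof -
  define c where "c = activation p lam u0"
  have c: "c \<in> optimal_solutions p s \<Phi> lam"
    using u0 by (simp add: fixed_region_def c_def)
  have "(norm (c - activation p lam (u t)))\<^sup>2 / 2 \<le> bregman p lam c (u t)"
    using c by (intro half_norm_square_le_bregman[OF assms(1)]) (simp add: optimal_solutions_def)
  also have "\<dots> \<le> bregman p lam c (u 0)"
    using bregman_along_solution_nonincreasing[OF assms(1) u c] \<open>0 \<le> t\<close> by simp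
  also have "\<dots> = 0"
    using u bregman_activation_self[OF assms(1)] by (simp add: lca_solution_def c_def)
  finally show ?thesis by (simp add: c_def)
qed

text \<open>The Bregman distance to an optimal point bounds the activation. Each coordinate of \<open>u\<close> then solves
  \<open>x' = c t - x\<close> with a bounded forcing \<open>c\<close>. A bound on the activation alone would not do: for
  CLASSO, \<open>T\<close> vanishes on arbitrarily negative coordinates.\<close>
lemma lca_solution_bounded:
  fixes s :: "real ^ 'm" and \<Phi> :: "real ^ 'n ^ 'm"
  assumes "0 < lam" and u: "lca_solution p s \<Phi> lam u0 u"
  shows "bounded (u ` {0..})"
proof -
  let ?G = "gradient_step s \<Phi>"
  have G: "lca_field p s \<Phi> lam (u t) = ?G (activation p lam (u t)) - u t" for t
    by (rule lca_field_eq)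
  obtain c where c: "c \<in> optimal_solutions p s \<Phi> lam"
    using optimal_solutions_nonempty[OF assms(1)] by blast
  define R where "R = sqrt (2 * bregman p lam c (u 0))"
  have a: "activation p lam (u t) \<in> cball c R" if "0 \<le> t" for t
  proof -
    have "(norm (c - activation p lam (u t)))\<^sup>2 / 2 \<le> bregman p lam c (u t)"
      using c assms(1) by (intro half_norm_square_le_bregman) (auto simp: optimal_solutions_def)
    also have "\<dots> \<le> bregman p lam c (u 0)"
      using bregman_along_solution_nonincreasing[OF _ u c, of 0 t] that assms(1) by simp
    finally show ?thesis
      unfolding R_def mem_cball dist_norm by (intro real_le_rsqrt) simp
  qed
  have "bounded (?G ` cball c R)"
    by (intro compact_imp_bounded compact_continuous_image compact_cball continuous_on_gradient_step)
  then obtain B where B: "\<And>x. x \<in> cball c R \<Longrightarrow> norm (?G x) \<le> B"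
    unfolding bounded_iff by blast
  have "0 \<le> B" using order_trans[OF norm_ge_zero B[OF a[of 0]]] by simp
  have "\<bar>u t $ n\<bar> \<le> B + \<bar>u 0 $ n\<bar>" if "0 \<le> t" for t n
  proof -
    have "\<bar>u t $ n - 0\<bar> \<le> B + exp (0 - t) * \<bar>u 0 $ n - 0\<bar>"
    proof (rule relaxation_bound[where c = "\<lambda>t. ?G (activation p lam (u t)) $ n"])
      show "((\<lambda>t. u t $ n) has_real_derivative ?G (activation p lam (u t)) $ n - u t $ n)
          (at t within {0..})" if "0 \<le> t" for t
        using lca_solution_nth_deriv[OF u that, of n] by (simp add: G)
      show "\<bar>?G (activation p lam (u t)) $ n - 0\<bar> \<le> B" if "0 \<le> t" for t
        using B[OF a[OF that]] component_le_norm_cart[of "?G (activation p lam (u t))" n] by simp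
    qed (use that \<open>0 \<le> B\<close> in auto)
    also have "exp (0 - t) * \<bar>u 0 $ n - 0\<bar> \<le> \<bar>u 0 $ n\<bar>"
      using that by (simp add: mult_left_le_one_le)
    finally show ?thesis by simp
  qed
  then have "norm (u t) \<le> (\<Sum>n\<in>UNIV. B + \<bar>u 0 $ n\<bar>)" if "0 \<le> t" for t
    using that by (intro order_trans[OF norm_le_l1_cart] sum_mono)
  then show ?thesis by (auto simp: bounded_iff)
qed

text \<open>As long as the energy exceeds \<open>E c + \<epsilon>\<close>, the Bregman distance to \<open>c\<close> falls at speed at least \<open>\<epsilon>\<close>,
  which a nonnegative quantity cannot sustain.\<close>
lemma energy_frequently_near_optimal:
  assumes "0 \<le> lam" and u: "lca_solution p s \<Phi> lam u0 u"
    and c: "c \<in> feasible p" and "0 < \<epsilon>" "0 \<le> t0"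
  shows "\<exists>t\<ge>t0. energy s \<Phi> lam (activation p lam (u t)) < energy s \<Phi> lam c + \<epsilon>"
proof (rule ccontr)
  let ?D = "\<lambda>t. bregman p lam c (u t)"
  assume "\<not> ?thesis"
  then have gap: "energy s \<Phi> lam c + \<epsilon> \<le> energy s \<Phi> lam (activation p lam (u t))" if "t0 \<le> t" for t
    using that by force
  have nonneg: "0 \<le> ?D t" for t
    using half_norm_square_le_bregman[OF assms(1) c, of "u t"] by (rule order_trans[rotated]) simp
  \<comment> \<open>At this time a decrease at speed \<open>\<epsilon>\<close> from \<open>t0\<close> on would have pushed \<open>?D\<close> to \<open>- 1\<close>.\<close>
  define T where "T = t0 + (?D t0 + 1) / \<epsilon>"
  have "t0 \<le> T" using nonneg[of t0] \<open>0 < \<epsilon>\<close> by (simp add: T_def)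
  have "?D T + \<epsilon> * T \<le> ?D t0 + \<epsilon> * t0"
  proof (rule nonincreasing_on_half_line[where f = "\<lambda>t. ?D t + \<epsilon> * t"])
    fix t :: real assume "0 \<le> t"
    show "((\<lambda>t. ?D t + \<epsilon> * t) has_real_derivative
        (activation p lam (u t) - c) \<bullet> lca_field p s \<Phi> lam (u t) + \<epsilon>) (at t within {0..})"
      by (auto intro!: derivative_eq_intros bregman_along_solution_deriv[OF assms(1) u \<open>0 \<le> t\<close>])
  next
    fix t assume "t0 \<le> t"
    then show "(activation p lam (u t) - c) \<bullet> lca_field p s \<Phi> lam (u t) + \<epsilon> \<le> 0"
      using bregman_dissipation[OF assms(1) c, of "u t" s \<Phi>] gap[of t] by simp
  qed fact+
  moreover have "\<epsilon> * T = \<epsilon> * t0 + ?D t0 + 1"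
    using \<open>0 < \<epsilon>\<close> by (simp add: T_def field_simps)
  ultimately show False using nonneg[of T] by simp
qed

lemma activation_tendsto:
  "0 \<le> lam \<Longrightarrow> (f \<longlongrightarrow> l) F \<Longrightarrow> ((\<lambda>x. activation p lam (f x)) \<longlongrightarrow> activation p lam l) F"
  using lipschitz_on_continuous_on[OF activation_lipschitz]
  by (intro continuous_on_tendsto_compose[where s = UNIV and f = "activation p lam"]) auto

text \<open>Along a sequence of times the energy tends to its minimum and, by boundedness, \<open>u\<close> to a point \<open>v\<close>;
  thus \<open>T v\<close> is optimal. Its Bregman distance is nonincreasing along the whole trajectory and tends to
  \<open>bregman p lam (T v) v = 0\<close> along the sequence, so \<open>T (u t)\<close> converges to \<open>T v\<close>. Finally \<open>u\<close> relaxes to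
  the limit of its forcing.\<close>
theorem lca_solution_converges:
  fixes s :: "real ^ 'm" and \<Phi> :: "real ^ 'n ^ 'm"
  assumes "0 < lam" and u: "lca_solution p s \<Phi> lam u0 u"
  obtains l where "(u \<longlongrightarrow> l) at_top" "l \<in> fixed_region p s \<Phi> lam"
proof -
  have lam: "0 \<le> lam" using assms(1) by simp
  let ?E = "energy s \<Phi> lam" and ?T = "activation p lam"
  obtain c where c: "c \<in> optimal_solutions p s \<Phi> lam"
    using optimal_solutions_nonempty[OF assms(1)] by blast
  then have cf: "c \<in> feasible p" and cE: "\<And>a. a \<in> feasible p \<Longrightarrow> ?E c \<le> ?E a"
    by (auto simp: optimal_solutions_def)
  have "\<exists>t\<ge>0. ?E (?T (u t)) < ?E c + 1 / real (Suc k)" for k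
    by (rule energy_frequently_near_optimal[OF lam u cf]) auto
  then obtain \<tau> where \<tau>: "\<And>k. 0 \<le> \<tau> k" "\<And>k. ?E (?T (u (\<tau> k))) < ?E c + 1 / real (Suc k)"
    by metis
  have "bounded (range (\<lambda>k. u (\<tau> k)))"
    by (rule bounded_subset[OF lca_solution_bounded[OF assms]]) (use \<tau>(1) in auto)
  then obtain v r where r: "strict_mono r" and v: "((\<lambda>k. u (\<tau> k)) \<circ> r) \<longlonglongrightarrow> v"
    using bounded_imp_convergent_subsequence by blast
  then have lim: "(\<lambda>k. u (\<tau> (r k))) \<longlonglongrightarrow> v" by (simp add: o_def)
  have "(\<lambda>k. ?E (?T (u (\<tau> (r k))))) \<longlonglongrightarrow> ?E (?T v)"
    by (rule continuous_on_tendsto_compose[OF continuous_on_energy[of UNIV] activation_tendsto[OF lam lim]])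
      auto
  moreover have "(\<lambda>k. ?E c + 1 / real (Suc (r k))) \<longlonglongrightarrow> ?E c + 0"
    by (intro tendsto_intros LIMSEQ_subseq_LIMSEQ[OF LIMSEQ_Suc[OF lim_1_over_n] r, unfolded o_def])
  ultimately have "?E (?T v) \<le> ?E c"
    using \<tau>(2) by (intro LIMSEQ_le[of "\<lambda>k. ?E (?T (u (\<tau> (r k))))" _ "\<lambda>k. ?E c + 1 / real (Suc (r k))"])
      (auto intro: less_imp_le)
  then have opt: "?T v \<in> optimal_solutions p s \<Phi> lam"
    using cE activation_feasible by (force simp: optimal_solutions_def)
  let ?D = "\<lambda>t. bregman p lam (?T v) (u t)"
  have D_ge: "(norm (?T v - ?T (u t)))\<^sup>2 / 2 \<le> ?D t" for t
    by (rule half_norm_square_le_bregman[OF lam activation_feasible])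
  have "(\<lambda>k. ?D (\<tau> (r k))) \<longlonglongrightarrow> bregman p lam (?T v) v"
    by (rule continuous_on_tendsto_compose[OF continuous_on_bregman[OF lam, of UNIV] lim]) auto
  then have D_seq: "(\<lambda>k. ?D (\<tau> (r k))) \<longlonglongrightarrow> 0"
    by (simp add: bregman_activation_self[OF lam])
  have aT: "((\<lambda>t. ?T (u t)) \<longlongrightarrow> ?T v) at_top"
  proof (rule tendstoI)
    fix \<epsilon> :: real assume "0 < \<epsilon>"
    then have "\<forall>\<^sub>F k in sequentially. ?D (\<tau> (r k)) < \<epsilon>\<^sup>2 / 2"
      by (intro order_tendstoD(2)[OF D_seq]) simp
    then obtain k where k: "?D (\<tau> (r k)) < \<epsilon>\<^sup>2 / 2"
      by (auto simp: eventually_sequentially)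
    show "\<forall>\<^sub>F t in at_top. dist (?T (u t)) (?T v) < \<epsilon>"
      using eventually_ge_at_top[of "\<tau> (r k)"]
    proof eventually_elim
      case (elim t)
      have "(norm (?T v - ?T (u t)))\<^sup>2 / 2 \<le> ?D t" by (rule D_ge)
      also have "\<dots> \<le> ?D (\<tau> (r k))"
        using bregman_along_solution_nonincreasing[OF lam u opt \<tau>(1) elim] .
      also note k
      finally have "(norm (?T v - ?T (u t)))\<^sup>2 < \<epsilon>\<^sup>2" by simp
      then show ?case
        using \<open>0 < \<epsilon>\<close> by (simp add: dist_norm norm_minus_commute power_less_imp_less_base)
    qed
  qed
  let ?G = "gradient_step s \<Phi>"
  have GT: "((\<lambda>t. ?G (?T (u t))) \<longlongrightarrow> ?G (?T v)) at_top"
    by (rule continuous_on_tendsto_compose[OF continuous_on_gradient_step[of UNIV] aT]) auto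
  have "((\<lambda>t. u t $ n) \<longlongrightarrow> ?G (?T v) $ n) at_top" for n
  proof (rule relaxation_tendsto)
    show "((\<lambda>t. u t $ n) has_real_derivative ?G (?T (u t)) $ n - u t $ n) (at t within {0..})"
      if "0 \<le> t" for t
      using lca_solution_nth_deriv[OF u that, of n] by (simp add: lca_field_eq)
    show "((\<lambda>t. ?G (?T (u t)) $ n) \<longlongrightarrow> ?G (?T v) $ n) at_top"
      by (rule tendsto_vec_nth[OF GT])
  qed
  then have lim_u: "(u \<longlongrightarrow> ?G (?T v)) at_top" by (rule vec_tendstoI)
  have "?T (?G (?T v)) = ?T v"
    by (rule tendsto_unique[OF _ activation_tendsto[OF lam lim_u] aT]) simp
  with opt lim_u show thesis by (intro that[OF lim_u]) (simp add: fixed_region_def)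
qed

section \<open>The fixed region as largest invariant set\<close>

text \<open>If \<open>W\<close> vanishes, active coordinates are at rest. The activation need not be differentiable in time,
  but its square is, with derivative \<open>0\<close>. Squares of the one-sided thresholds are used because
  these are nonnegative, so that the constancy of the square yields that of the value; the factor
  \<open>\<sigma> = \<plusminus>1\<close> selects the side.\<close>
lemma activation_constant_if_W_zero:
  assumes "0 \<le> lam" and u: "lca_solution p s \<Phi> lam u0 u"
    and W: "\<And>t. 0 \<le> t \<Longrightarrow> lca_W p s \<Phi> lam (u t) = 0" and "0 \<le> t"
  shows "activation p lam (u t) = activation p lam u0"
proof -
  have rest: "threshold p lam (u t $ n) \<noteq> 0 \<Longrightarrow> lca_field p s \<Phi> lam (u t) $ n = 0" if "0 \<le> t" for t n
    using W[OF that] by (simp add: lca_W_eq_zero_iff[OF assms(1)] active_def)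
  have const: "one_sided_threshold lam (\<sigma> * u t $ n) = one_sided_threshold lam (\<sigma> * u 0 $ n)"
    if \<sigma>: "\<And>x. one_sided_threshold lam (\<sigma> * x) \<noteq> 0 \<Longrightarrow> threshold p lam x \<noteq> 0" for \<sigma> n
  proof -
    have "((\<lambda>t. (one_sided_threshold lam (\<sigma> * u t $ n))\<^sup>2 / 2) has_real_derivative 0)
        (at t within {0..})" if "0 \<le> t" for t
    proof -
      have "((\<lambda>t. (one_sided_threshold lam (\<sigma> * u t $ n))\<^sup>2 / 2) has_real_derivative
          one_sided_threshold lam (\<sigma> * u t $ n) * (\<sigma> * lca_field p s \<Phi> lam (u t) $ n))
          (at t within {0..})"
        by (rule DERIV_chain2[OF half_square_one_sided_threshold_deriv
              DERIV_cmult[OF lca_solution_nth_deriv[OF u that]]])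
      moreover have "one_sided_threshold lam (\<sigma> * u t $ n) * (\<sigma> * lca_field p s \<Phi> lam (u t) $ n) = 0"
        using \<sigma>[of "u t $ n"] rest[OF that, of n] by auto
      ultimately show ?thesis by simp
    qed
    then obtain k where "\<And>t. 0 \<le> t \<Longrightarrow> (one_sided_threshold lam (\<sigma> * u t $ n))\<^sup>2 / 2 = k"
      using has_field_derivative_zero_constant[of "{0..}" "\<lambda>t. (one_sided_threshold lam (\<sigma> * u t $ n))\<^sup>2 / 2"]
      by auto
    from this[of t] this[of 0] \<open>0 \<le> t\<close>
    have "(one_sided_threshold lam (\<sigma> * u t $ n))\<^sup>2 = (one_sided_threshold lam (\<sigma> * u 0 $ n))\<^sup>2"
      by simp
    then show ?thesis by (simp add: one_sided_threshold_nonneg)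
  qed
  have "threshold p lam (u t $ n) = threshold p lam (u 0 $ n)" for n
  proof (cases p)
    case LASSO
    then show ?thesis
      using const[of 1 n] const[of "- 1" n] assms(1)
      by (auto simp: one_sided_threshold_def split: if_splits)
  next
    case CLASSO
    then show ?thesis using const[of 1 n] by simp
  qed
  with u show ?thesis by (simp add: vec_eq_iff lca_solution_def)
qed

text \<open>The trajectory keeps its activation, and an active coordinate is determined by its activation; hence
  it is at rest, and the field, being its derivative at time \<open>0\<close>, vanishes there.\<close>
lemma lca_W_zero_on_fixed_region:
  assumes "0 \<le> lam" "u0 \<in> fixed_region p s \<Phi> lam"
  shows "lca_W p s \<Phi> lam u0 = 0"
proof -
  obtain u where u: "lca_solution p s \<Phi> lam u0 u"
    using lca_solution_exists[OF assms(1)] .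
  have "lca_field p s \<Phi> lam u0 $ n = 0" if n: "n \<in> active (activation p lam u0)" for n
  proof -
    have "u t $ n = u0 $ n" if "0 \<le> t" for t
    proof -
      have "threshold p lam (u t $ n) = threshold p lam (u0 $ n)"
        using activation_fixed_along_solution_from_fixed_region[OF assms(1) u assms(2) that]
        by (metis activation_nth)
      with n threshold_residual_active[OF assms(1), of p "u t $ n"]
        threshold_residual_active[OF assms(1), of p "u0 $ n"]
      show ?thesis by (simp add: active_def)
    qed
    then have "((\<lambda>t. u t $ n) has_real_derivative 0) (at 0 within {0..})"
      by (intro has_field_derivative_transform_within[OF DERIV_const[of "u0 $ n"], of 1]) auto
    moreover have "((\<lambda>t. u t $ n) has_real_derivative lca_field p s \<Phi> lam u0 $ n) (at 0 within {0..})"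
      using lca_solution_nth_deriv[OF u, of 0 n] u by (simp add: lca_solution_def)
    ultimately show ?thesis
      by (intro has_field_derivative_unique[of _ _ 0 "{0..}"]) (auto simp: at_within_Ici_at_right)
  qed
  then show ?thesis by (simp add: lca_W_eq_zero_iff[OF assms(1)])
qed

lemma positive_invariant_fixed_region:
  assumes "0 \<le> lam"
  shows "positive_invariant p s \<Phi> lam (fixed_region p s \<Phi> lam)"
  unfolding positive_invariant_def
proof (intro ballI allI impI)
  fix u0 and t :: real
  assume u0: "u0 \<in> fixed_region p s \<Phi> lam" and "0 \<le> t"
  obtain u where u: "lca_solution p s \<Phi> lam u0 u"
    using lca_solution_exists[OF assms(1)] .
  show "lca_flow p s \<Phi> lam t u0 \<in> fixed_region p s \<Phi> lam"
    using u0 activation_fixed_along_solution_from_fixed_region[OF assms u u0 \<open>0 \<le> t\<close>]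
    by (simp add: lca_flow_eq_solution[OF assms u \<open>0 \<le> t\<close>] fixed_region_def)
qed

text \<open>On such a trajectory the activation is constant; since trajectories converge into the fixed
  region, the constant value must already be optimal.\<close>
lemma positive_invariant_subset_fixed_region:
  assumes "0 < lam" and inv: "positive_invariant p s \<Phi> lam X"
    and X: "X \<subseteq> {u. lca_W p s \<Phi> lam u = 0}"
  shows "X \<subseteq> fixed_region p s \<Phi> lam"
proof
  fix u0 assume "u0 \<in> X"
  have lam: "0 \<le> lam" using assms(1) by simp
  obtain u where u: "lca_solution p s \<Phi> lam u0 u"
    using lca_solution_exists[OF lam] .
  have "lca_W p s \<Phi> lam (u t) = 0" if "0 \<le> t" for t
    using inv X \<open>u0 \<in> X\<close> that
    by (auto simp: positive_invariant_def simp flip: lca_flow_eq_solution[OF lam u that])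
  then have const: "activation p lam (u t) = activation p lam u0" if "0 \<le> t" for t
    using activation_constant_if_W_zero[OF lam u] that by blast
  obtain l where l: "(u \<longlongrightarrow> l) at_top" "l \<in> fixed_region p s \<Phi> lam"
    using lca_solution_converges[OF assms(1) u] .
  have "((\<lambda>t. activation p lam (u t)) \<longlongrightarrow> activation p lam u0) at_top"
    by (rule tendsto_eventually, rule eventually_mono[OF eventually_ge_at_top[of 0]]) (rule const)
  then have "activation p lam l = activation p lam u0"
    by (rule tendsto_unique[OF _ activation_tendsto[OF lam l(1)], rotated]) simp
  with l(2) show "u0 \<in> fixed_region p s \<Phi> lam" by (simp add: fixed_region_def)
qed

lemma converges_to_set_if_tendsto:
  assumes "(x \<longlongrightarrow> l) at_top" "l \<in> X"
  shows "converges_to_set x X"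
  unfolding converges_to_set_def
proof
  show "X \<noteq> {}" using assms(2) by blast
  have "((\<lambda>t. infdist (x t) X) \<longlongrightarrow> infdist l X) at_top"
    by (intro tendsto_infdist assms(1))
  with assms(2) show "((\<lambda>t. infdist (x t) X) \<longlongrightarrow> 0) at_top" by simp
qed

theorem theorem6:
  fixes p :: lca_problem
    and s :: "real ^ 'm"
    and \<Phi> :: "real ^ 'n ^ 'm"
    and lam :: real
  assumes lambda_pos: "lam > 0"
    and unit_columns: "\<And>n. norm (column n \<Phi>) = 1"
  shows "(\<forall>M. largest_positive_invariant_inside p s \<Phi> lam {u. lca_W p s \<Phi> lam u = 0} M
              \<longleftrightarrow> M = fixed_region p s \<Phi> lam)
       \<and> (\<forall>u0. converges_to_set (\<lambda>t. lca_flow p s \<Phi> lam t u0) (fixed_region p s \<Phi> lam)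
              \<and> converges_to_set (\<lambda>t. activation p lam (lca_flow p s \<Phi> lam t u0))
                  (optimal_solutions p s \<Phi> lam))"
proof (intro conjI allI)
  have lam: "0 \<le> lam" using lambda_pos by simp
  let ?S = "{u. lca_W p s \<Phi> lam u = 0}"
  have "largest_positive_invariant_inside p s \<Phi> lam ?S (fixed_region p s \<Phi> lam)"
    unfolding largest_positive_invariant_inside_def
    using positive_invariant_fixed_region[OF lam] lca_W_zero_on_fixed_region[OF lam]
      positive_invariant_subset_fixed_region[OF lambda_pos] by blast
  then show "largest_positive_invariant_inside p s \<Phi> lam ?S M \<longleftrightarrow> M = fixed_region p s \<Phi> lam" for M
    unfolding largest_positive_invariant_inside_def by blast
  fix u0
  obtain u where u: "lca_solution p s \<Phi> lam u0 u"
    using lca_solution_exists[OF lam] .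
  obtain l where l: "(u \<longlongrightarrow> l) at_top" "l \<in> fixed_region p s \<Phi> lam"
    using lca_solution_converges[OF lambda_pos u] .
  have "\<forall>\<^sub>F t in at_top. u t = lca_flow p s \<Phi> lam t u0"
    using eventually_ge_at_top[of 0] by eventually_elim (simp add: lca_flow_eq_solution[OF lam u])
  with l(1) have flow: "((\<lambda>t. lca_flow p s \<Phi> lam t u0) \<longlongrightarrow> l) at_top"
    by (rule Lim_transform_eventually)
  show "converges_to_set (\<lambda>t. lca_flow p s \<Phi> lam t u0) (fixed_region p s \<Phi> lam)"
    using flow l(2) by (rule converges_to_set_if_tendsto)
  show "converges_to_set (\<lambda>t. activation p lam (lca_flow p s \<Phi> lam t u0)) (optimal_solutions p s \<Phi> lam)"
    using activation_tendsto[OF lam flow] l(2)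
    by (intro converges_to_set_if_tendsto) (auto simp: fixed_region_def)
qed

end
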